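(* Let $q$ be a power of a prime, let $m$ be a positive integer, let $Q = (q^m-1)/(q-1)$, and let $\alpha$ be a primitive element of $\mathbb{F}_{q^m}$. Let $N$ be a positive divisor of $q^m-1$ and let $c$ be an arbitrary element of $\mathbb{F}_q$. Then $$Z_{q,m, N}(c) = \frac{1}{q}\left( \frac{q^m-1}{N} \phi(N) + f_0(N, c, \Delta) \right).$$
   Context: $\phi$ is Euler's function, $\mu$ the Möbius function, and divisors are positive. For a positive divisor $N$ of $q^m-1$, a non-zero element $\xi \in \mathbb{F}_{q^m}^*$ is called $N$-free if, for any $d \mid N$, $\xi = \gamma^d$ with $\gamma \in \mathbb{F}_{q^m}$ implies $d=1$; equivalently $\xi = \alpha^k$ for some integer $k$ coprime to $N$. For $c \in \mathbb{F}_q$, $Z_{q,m,N}(c)$ denotes the number of $N$-free elements $\xi \in \mathbb{F}_{q^m}^*$ with $\operatorname{Tr}_{\mathbb{F}_{q^m}/\mathbb{F}_q}(\xi) = c$. Let $p$ be the characteristic of $\mathbb{F}_q$. The canonical additive characters are $\chi_q(x) = e^{2\pi\sqrt{-1}\operatorname{Tr}_{\mathbb{F}_{q}/\mathbb{F}_p}(x)/p}$ for $x \in \mathbb{F}_q$ and $\chi_{q^m}(z) = e^{2\pi\sqrt{-1}\operatorname{Tr}_{\mathbb{F}_{q^m}/\mathbb{F}_p}(z)/p}$ for $z\in\mathbb{F}_{q^m}$. For $d \mid q^m-1$ and $k \in \mathbb{Z}$, the $k$-th Gaussian period of type $(d,q^m)$ is $\eta_k^{(d,q^m)} = \sum_{x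 \in \alpha^k\langle \alpha^d\rangle} \chi_{q^m}(x)$. Put $\Delta_k(N) = \sum_{d \mid N} \mu(d)\, \eta_k^{(d,q^m)}$ and $$f_k(N, c, \Delta) = \sum_{i=0}^{q-2}\overline{\chi_q\left( \alpha^{Qi}c \right)}\, \Delta_{Qi + k}(N),$$ where $\alpha^{Q i} \in \mathbb{F}_q^*$. *)

theory Defs
  imports "HOL-Analysis.Analysis" "HOL-Computational_Algebra.Squarefree" "HOL-Number_Theory.Number_Theory"
begin

(* The field with q^m elements is a finite field type 'a with CARD('a) = q^m, and
   the field with q elements is a subset K of it satisfying is_subfield K and
   card K = q. *)

definition is_subfield :: "'a :: field set \<Rightarrow> bool" where
  "is_subfield K \<longleftrightarrow> 0 \<in> K \<and> 1 \<in> K \<and>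
     (\<forall>x\<in>K. \<forall>y\<in>K. x + y \<in> K \<and> x * y \<in> K) \<and>
     (\<forall>x\<in>K. - x \<in> K \<and> inverse x \<in> K)"

definition primitive_element :: "'a :: field \<Rightarrow> bool" where
  "primitive_element \<alpha> \<longleftrightarrow> \<alpha> \<noteq> 0 \<and> (\<forall>x. x \<noteq> 0 \<longrightarrow> (\<exists>k::nat. x = \<alpha> ^ k))"

definition moebius :: "nat \<Rightarrow> int" where
  "moebius n = (if squarefree n then (-1) ^ card (prime_factors n) else 0)"

(* Trace from the field with s^n elements to its subfield with s elements, as the
   sum of the conjugates x, x^s, ..., x^(s^(n-1)). *)
definition gf_trace :: "nat \<Rightarrow> nat \<Rightarrow> 'a :: field \<Rightarrow> 'a" where
  "gf_trace s n x = (\<Sum>i<n. x ^ (s ^ i))"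

(* For x in the prime field, the representative of x in {0..<p}, where p is the
   characteristic. *)
definition prime_field_rep :: "'a :: field \<Rightarrow> nat" where
  "prime_field_rep x = (LEAST k. of_nat k = x)"

(* Canonical additive character of the subfield of 'a with s elements. If p is the
   characteristic, then s = p ^ multiplicity p s, so that multiplicity p s is the
   degree over the prime field. *)
definition canonical_char :: "nat \<Rightarrow> 'a :: field \<Rightarrow> complex" where
  "canonical_char s x =
     exp (2 * of_real pi * \<i> *
       of_nat (prime_field_rep (gf_trace CHAR('a) (multiplicity CHAR('a) s) x)) /
       of_nat CHAR('a))"

definition N_free :: "nat \<Rightarrow> 'a :: field \<Rightarrow> bool" where
  "N_free N \<xi> \<longleftrightarrow> \<xi> \<noteq> 0 \<and> (\<forall>d. d dvd N \<longrightarrow> (\<exists>\<gamma>. \<xi> = \<gamma> ^ d) \<longrightarrow> d = 1)"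

definition Z_count :: "nat \<Rightarrow> nat \<Rightarrow> nat \<Rightarrow> 'a :: field \<Rightarrow> nat" where
  "Z_count q m N c = card {\<xi>. N_free N \<xi> \<and> gf_trace q m \<xi> = c}"

definition power_coset :: "'a :: field \<Rightarrow> int \<Rightarrow> nat \<Rightarrow> 'a set" where
  "power_coset \<alpha> k d = {\<alpha> powi k * (\<alpha> ^ d) powi j | j. True}"

definition gaussian_period :: "'a :: {field, finite} \<Rightarrow> nat \<Rightarrow> int \<Rightarrow> complex" where
  "gaussian_period \<alpha> d k = (\<Sum>x\<in>power_coset \<alpha> k d. canonical_char CARD('a) x)"

definition Delta :: "'a :: {field, finite} \<Rightarrow> int \<Rightarrow> nat \<Rightarrow> complex" where
  "Delta \<alpha> k N = (\<Sum>d | d dvd N. of_int (moebius d) * gaussian_period \<alpha> d k)"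

definition f_sum ::
  "nat \<Rightarrow> nat \<Rightarrow> 'a :: field \<Rightarrow> int \<Rightarrow> nat \<Rightarrow> 'a \<Rightarrow> (int \<Rightarrow> nat \<Rightarrow> complex) \<Rightarrow> complex" where
  "f_sum q Q \<alpha> k N c D =
     (\<Sum>i = 0..q - 2. cnj (canonical_char q (\<alpha> ^ (Q * i) * c)) * D (int (Q * i) + k) N)"

end

theory Submission
  imports Defs
begin

text \<open>The additive characters of \<open>K\<close> detect the value of the trace. By orthogonality over \<open>K\<close>,
  \<open>\<Sum>y\<in>K. \<chi>\<^sub>q (y (Tr \<xi> - c))\<close> is \<open>q\<close> if \<open>Tr \<xi> = c\<close> and \<open>0\<close> otherwise,
  and since the trace is \<open>K\<close>-linear and transitive, \<open>\<chi>\<^sub>q (y Tr \<xi>)\<close> is the character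
  \<open>\<chi>\<close> of the large field at \<open>y \<xi>\<close>. Summing over the \<open>N\<close>-free \<open>\<xi>\<close> gives
  \<open>q Z(c) = (\<Sum>y\<in>K. cnj (\<chi>\<^sub>q (y c)) * (\<Sum>\<xi>. \<chi> (y \<xi>)))\<close>.

  The term \<open>y = 0\<close> is the number of \<open>N\<close>-free elements. These are the powers \<open>\<alpha>\<^sup>k\<close>
  with \<open>k\<close> coprime to \<open>N\<close> (\<open>N_free_primitive_power_iff\<close>), and a full set of exponents
  consists of \<open>(q\<^sup>m - 1) / N\<close> blocks of length \<open>N\<close>, each with \<open>totient N\<close> such \<open>k\<close>
  (\<open>card_N_free\<close>).

  For \<open>y \<noteq> 0\<close> write \<open>y = \<alpha>\<^sup>j\<close>; here \<open>j\<close> runs through the multiples \<open>Q i\<close> with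
  \<open>i \<le> q - 2\<close> (\<open>bij_betw_primitive_power_subfield\<close>). The indicator of being \<open>N\<close>-free
  is the sum of the Moebius function over the divisors \<open>d\<close> of \<open>N\<close> for which \<open>\<xi>\<close> is a
  \<open>d\<close>-th power (\<open>sum_moebius_eq_N_free\<close>), and the sum of the character over \<open>\<alpha>\<^sup>j\<close> times the
  \<open>d\<close>-th powers is a Gaussian period. Hence the inner sum is \<open>Delta \<alpha> j N\<close>
  (\<open>Delta_eq_sum_N_free\<close>).

  Orthogonality (\<open>canonical_char_orthogonality\<close>) needs a character that is non-trivial on \<open>K\<close>,
  that is, an element of \<open>K\<close> with non-zero absolute trace; there is one because the absolute
  trace is a polynomial with fewer roots than \<open>K\<close> has elements
  (\<open>gf_trace_nonzero_exists\<close>). It also needs the relative trace to take values in \<open>K\<close>, which holds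
  since \<open>K\<close> is the set of fixed points of the \<open>q\<close>-th power map
  (\<open>subfield_eq_fixed_points\<close>).\<close>

section \<open>The sum of the Moebius function over divisors\<close>

lemma moebius_times_prime:
  assumes p: "prime p" and ndvd: "\<not> p dvd d"
  shows "moebius (p * d) = - moebius d"
proof (cases "squarefree d")
  case True
  have "d \<noteq> 0"
    using ndvd by (metis dvd_0_right)
  have "squarefree (p * d)"
    by (rule squarefree_mult_coprime[OF prime_imp_coprime[OF p ndvd] squarefree_prime[OF p] True])
  moreover have "prime_factors (p * d) = insert p (prime_factors d)"
    using p \<open>d \<noteq> 0\<close> by (simp add: prime_factors_product prime_factorization_prime prime_gt_0_nat)
  moreover have "p \<notin> prime_factors d"
    using ndvd by auto
  ultimately show ?thesis
    using True by (simp add: moebius_def)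
next
  case False
  then have "\<not> squarefree (p * d)"
    by (meson squarefree_multD)
  with False show ?thesis
    by (simp add: moebius_def)
qed

text \<open>For a prime \<open>p\<close> dividing \<open>n\<close>, multiplication by \<open>p\<close> pairs the squarefree divisors not
  divisible by \<open>p\<close> with those divisible by \<open>p\<close>, and the terms of a pair cancel.\<close>

lemma sum_moebius_divisors:
  fixes n :: nat
  assumes "n > 0"
  shows "(\<Sum>d | d dvd n. moebius d) = (if n = 1 then 1 else 0)"
proof (cases "n = 1")
  case True
  then show ?thesis
    by (simp add: moebius_def)
next
  case False
  then obtain p where p: "prime p" "p dvd n"
    using prime_factor_nat by blast
  define S where "S = {d. d dvd n \<and> squarefree d \<and> \<not> p dvd d}"
  have fin: "finite {d. d dvd n}"
    using assms by simp
  then have finS: "finite S"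
    by (rule finite_subset[rotated]) (auto simp: S_def)
  have split: "{d. d dvd n \<and> squarefree d} = S \<union> (*) p ` S"
  proof (intro equalityI subsetI)
    fix d assume d: "d \<in> {d. d dvd n \<and> squarefree d}"
    show "d \<in> S \<union> (*) p ` S"
    proof (cases "p dvd d")
      case True
      then obtain d' where d': "d = p * d'" ..
      have "\<not> p dvd d'"
      proof
        assume "p dvd d'"
        then have "p ^ 2 dvd d"
          by (simp add: d' power2_eq_square)
        then show False
          using d p squarefreeD[of d p] by auto
      qed
      moreover have "squarefree d'" "d' dvd n"
        using d by (auto simp: d' dest: squarefree_multD dvd_mult_right)
      ultimately show ?thesis
        by (auto simp: S_def d')
    qed (use d in \<open>auto simp: S_def\<close>)
  next
    have "p * d' dvd n \<and> squarefree (p * d')" if "d' \<in> S" for d'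
    proof -
      have "coprime p d'"
        using p that by (auto simp: S_def intro: prime_imp_coprime)
      then show ?thesis
        using p that by (auto simp: S_def divides_mult squarefree_mult_coprime squarefree_prime)
    qed
    moreover fix d assume "d \<in> S \<union> (*) p ` S"
    ultimately show "d \<in> {d. d dvd n \<and> squarefree d}"
      by (auto simp: S_def)
  qed
  have "(\<Sum>d | d dvd n. moebius d) = (\<Sum>d | d dvd n \<and> squarefree d. moebius d)"
    by (rule sum.mono_neutral_right) (use fin in \<open>auto simp: moebius_def\<close>)
  also have "\<dots> = (\<Sum>d\<in>S. moebius d) + (\<Sum>d\<in>(*) p ` S. moebius d)"
    unfolding split using finS by (intro sum.union_disjoint) (auto simp: S_def)
  also have "(\<Sum>d\<in>(*) p ` S. moebius d) = (\<Sum>d\<in>S. moebius (p * d))"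
    using p by (subst sum.reindex) (auto intro!: inj_onI simp: prime_gt_0_nat)
  also have "\<dots> = (\<Sum>d\<in>S. - moebius d)"
    using p by (intro sum.cong) (auto simp: S_def moebius_times_prime)
  finally show ?thesis
    using False by (simp add: sum_negf)
qed

section \<open>Subfields of a finite field as fixed points of a power map\<close>

lemma is_subfield_UNIV: "is_subfield UNIV"
  by (simp add: is_subfield_def)

text \<open>Multiplication by \<open>x\<close> permutes the non-zero elements of \<open>K\<close>, so their product is
  unchanged when it is multiplied by \<open>x\<close> to the power \<open>card K - 1\<close>.\<close>

lemma subfield_power_card_minus_1:
  fixes K :: "'a :: {field, finite} set"
  assumes K: "is_subfield K" and x: "x \<in> K" "x \<noteq> 0"
  shows "x ^ (card K - 1) = 1"
proof -
  let ?U = "K - {0}"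
  have bij: "bij_betw ((*) x) ?U ?U"
  proof (rule bij_betwI[where g = "(*) (inverse x)"])
    show "(*) x \<in> ?U \<rightarrow> ?U" "(*) (inverse x) \<in> ?U \<rightarrow> ?U"
      using K x by (auto simp: is_subfield_def)
  qed (use x in auto)
  have "(\<Prod>y\<in>?U. y) = (\<Prod>y\<in>?U. x * y)"
    by (rule prod.reindex_bij_betw[OF bij, symmetric])
  also have "\<dots> = x ^ card ?U * (\<Prod>y\<in>?U. y)"
    by (simp add: prod.distrib)
  finally have "x ^ card ?U = 1"
    by simp
  then show ?thesis
    using K by (simp add: is_subfield_def)
qed

lemma card_power_fixed_points_le:
  fixes s :: nat
  assumes "s > 1"
  shows "card {x :: 'a :: field. x ^ s = x} \<le> s"
proof -
  let ?P = "Polynomial.monom 1 s - Polynomial.monom 1 1 :: 'a poly"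
  have "Polynomial.coeff ?P s = 1"
    using assms by simp
  then have "?P \<noteq> 0"
    by (metis coeff_0 zero_neq_one)
  then have "card {x. poly ?P x = 0} \<le> degree ?P"
    by (rule card_poly_roots_bound)
  also have "degree ?P \<le> s"
    using assms by (intro degree_diff_le) (auto simp: degree_monom_eq)
  finally show ?thesis
    by (simp add: poly_monom)
qed

lemma card_subfield_gt_1:
  fixes K :: "'a :: {field, finite} set"
  assumes "is_subfield K"
  shows "card K > 1"
proof -
  have "card {0, 1 :: 'a} \<le> card K"
    using assms by (intro card_mono) (auto simp: is_subfield_def)
  then show ?thesis
    by simp
qed

text \<open>The elements of \<open>K\<close> already exhaust the possible number of roots of
  \<open>X\<^sup>s - X\<close> for \<open>s = card K\<close>.\<close>

lemma subfield_eq_fixed_points: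
  fixes K :: "'a :: {field, finite} set"
  assumes K: "is_subfield K"
  shows "K = {x. x ^ card K = x}"
proof (rule card_seteq)
  show "K \<subseteq> {x. x ^ card K = x}"
  proof
    fix x assume x: "x \<in> K"
    have "x ^ card K = x * x ^ (card K - 1)"
      using card_subfield_gt_1[OF K] by (simp flip: power_Suc)
    also have "\<dots> = x"
      using subfield_power_card_minus_1[OF K x] by (cases "x = 0") simp_all
    finally show "x \<in> {x. x ^ card K = x}"
      by simp
  qed
  show "card {x :: 'a. x ^ card K = x} \<le> card K"
    using card_subfield_gt_1[OF K] by (rule card_power_fixed_points_le)
qed simp

lemma prime_CHAR_finite_field: "prime CHAR('a :: {field, finite})"
  by (intro prime_CHAR_semidom finite_imp_CHAR_pos) simp

lemma CHAR_finite_field_neq_0 [simp]: "CHAR('a :: {field, finite}) \<noteq> 0"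
  using prime_CHAR_finite_field[where 'a = 'a] by auto

lemma of_nat_power_CHAR:
  "(of_nat k :: 'a :: {field, finite}) ^ CHAR('a) = of_nat k"
  using prime_CHAR_finite_field[where 'a = 'a]
  by (induction k) (auto simp: freshmans_dream prime_gt_0_nat power_0_left)

text \<open>The polynomial \<open>X\<^sup>p - X\<close> has at most \<open>p\<close> roots, and the elements of the prime field
  already provide that many.\<close>

lemma fixed_by_CHAR_imp_of_nat:
  fixes x :: "'a :: {field, finite}"
  assumes "x ^ CHAR('a) = x"
  shows "\<exists>k. of_nat k = x"
proof -
  let ?p = "CHAR('a)"
  have p: "prime ?p"
    by (rule prime_CHAR_finite_field)
  have inj: "inj_on (of_nat :: nat \<Rightarrow> 'a) {..<?p}"
    by (rule inj_onI) (auto simp: of_nat_eq_iff_cong_CHAR cong_def)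
  have "of_nat ` {..<?p} = {x :: 'a. x ^ ?p = x}"
  proof (rule card_seteq)
    show "card {x :: 'a. x ^ ?p = x} \<le> card (of_nat ` {..<?p} :: 'a set)"
      using card_power_fixed_points_le[OF prime_gt_1_nat[OF p], where 'a = 'a]
      by (simp add: card_image[OF inj])
  qed (auto simp: of_nat_power_CHAR)
  then have "x \<in> of_nat ` {..<?p}"
    using assms by simp
  then show ?thesis
    by auto
qed

section \<open>Traces\<close>

lemma gf_trace_add:
  fixes x y :: "'a :: {field, finite}"
  assumes "s = CHAR('a) ^ e"
  shows "gf_trace s n (x + y) = gf_trace s n x + gf_trace s n y"
proof -
  have "(x + y) ^ (s ^ i) = x ^ (s ^ i) + y ^ (s ^ i)" for i
    by (rule freshmans_dream'[OF prime_CHAR_finite_field, where n = "e * i"])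
       (simp add: assms power_mult)
  then show ?thesis
    by (simp add: gf_trace_def sum.distrib)
qed

lemma power_power_fixed:
  fixes x :: "'a :: monoid_mult"
  assumes "x ^ s = x"
  shows "x ^ (s ^ i) = x"
  using assms by (induction i) (simp_all add: power_mult)

lemma gf_trace_scale:
  fixes x y :: "'a :: field"
  assumes "y ^ s = y"
  shows "gf_trace s n (y * x) = y * gf_trace s n x"
  using power_power_fixed[OF assms]
  by (simp add: gf_trace_def power_mult_distrib sum_distrib_left)

text \<open>The \<open>s\<close>-th power map cyclically permutes the conjugates of \<open>x\<close>.\<close>

lemma gf_trace_fixed:
  fixes x :: "'a :: {field, finite}"
  assumes s: "s = CHAR('a) ^ e" and x: "x ^ (s ^ n) = x"
  shows "gf_trace s n x ^ s = gf_trace s n x"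
proof -
  have "gf_trace s n x ^ s = (\<Sum>i<n. (x ^ (s ^ i)) ^ s)"
    unfolding gf_trace_def by (rule freshmans_dream_sum'[OF prime_CHAR_finite_field s])
  also have "\<dots> = (\<Sum>i<n. x ^ (s ^ Suc i))"
    by (simp add: mult.commute flip: power_mult)
  also have "\<dots> = (\<Sum>i<n. x ^ (s ^ i))"
    using x sum.lessThan_Suc_shift[of "\<lambda>i. x ^ (s ^ i)" n] by (simp add: add.commute)
  finally show ?thesis
    by (simp add: gf_trace_def)
qed

text \<open>Transitivity of the trace: each exponent below \<open>e * m\<close> is uniquely \<open>i + e * j\<close> with
  \<open>i < e\<close> and \<open>j < m\<close>.\<close>

lemma gf_trace_tower:
  fixes x :: "'a :: {field, finite}"
  defines "p \<equiv> CHAR('a)"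
  shows "gf_trace p e (gf_trace (p ^ e) m x) = gf_trace p (e * m) x"
proof -
  have "gf_trace p e (gf_trace (p ^ e) m x) = (\<Sum>i<e. \<Sum>j<m. (x ^ ((p ^ e) ^ j)) ^ (p ^ i))"
    unfolding gf_trace_def p_def
    by (simp add: freshmans_dream_sum'[OF prime_CHAR_finite_field refl])
  also have "\<dots> = (\<Sum>j<m. \<Sum>i<e. x ^ (p ^ (i + j * e)))"
    by (subst sum.swap) (simp add: power_add mult.commute flip: power_mult)
  also have "\<dots> = (\<Sum>j<m. \<Sum>k\<in>{j * e..<j * e + e}. x ^ (p ^ k))"
  proof (rule sum.cong)
    fix j
    show "(\<Sum>i<e. x ^ (p ^ (i + j * e))) = (\<Sum>k\<in>{j * e..<j * e + e}. x ^ (p ^ k))"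
      using sum.shift_bounds_nat_ivl[of "\<lambda>k. x ^ (p ^ k)" 0 "j * e" e]
      by (simp add: lessThan_atLeast0 add.commute)
  qed simp
  also have "\<dots> = (\<Sum>k<m * e. x ^ (p ^ k))"
    by (rule sum.nat_group)
  finally show ?thesis
    by (simp add: gf_trace_def mult.commute)
qed

text \<open>As a polynomial in \<open>x\<close> the absolute trace has degree smaller than \<open>card K\<close>, so it cannot
  vanish on all of \<open>K\<close>.\<close>

lemma gf_trace_nonzero_exists:
  fixes K :: "'a :: {field, finite} set"
  assumes cardK: "card K = CHAR('a) ^ e" and e: "e > 0"
  shows "\<exists>x\<in>K. gf_trace CHAR('a) e x \<noteq> 0"
proof (rule ccontr)
  let ?p = "CHAR('a)"
  assume "\<not> ?thesis"
  then have zero: "gf_trace ?p e x = 0" if "x \<in> K" for x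
    using that by blast
  have p: "?p > 1"
    using prime_CHAR_finite_field prime_gt_1_nat by blast
  define P :: "'a poly" where "P = (\<Sum>i<e. Polynomial.monom 1 (?p ^ i))"
  have "Polynomial.coeff P 1 = (\<Sum>i<e. if i = 0 then 1 else 0)"
    unfolding P_def coeff_sum by (intro sum.cong) (use p in auto)
  also have "\<dots> = 1"
    using e by simp
  finally have "P \<noteq> 0"
    by (metis coeff_0 zero_neq_one)
  have "card K \<le> card {x. poly P x = 0}"
    using zero by (intro card_mono) (auto simp: P_def poly_sum poly_monom gf_trace_def)
  also have "\<dots> \<le> degree P"
    using \<open>P \<noteq> 0\<close> by (rule card_poly_roots_bound)
  also have "\<dots> \<le> ?p ^ (e - 1)"
    unfolding P_def
    by (rule degree_sum_le) (use p in \<open>auto intro!: order.trans[OF degree_monom_le] power_increasing\<close>)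
  also have "\<dots> < ?p ^ e"
    using p e by (intro power_strict_increasing) auto
  finally show False
    using cardK by simp
qed

section \<open>The canonical additive character\<close>

text \<open>The exponential depends only on \<open>k\<close> modulo the characteristic, so it does not matter that
  the representatives used by the canonical character are not additive.\<close>

lemma exp_cong_CHAR:
  assumes "of_nat k = (of_nat l :: 'a :: {field, finite})"
  shows "exp (2 * of_real pi * \<i> * of_nat k / of_nat CHAR('a)) =
    exp (2 * of_real pi * \<i> * of_nat l / of_nat CHAR('a))"
proof -
  let ?p = "CHAR('a)"
  have p: "?p > 0"
    using prime_CHAR_finite_field prime_gt_0_nat by blast
  have "exp (2 * of_real pi * \<i> * of_nat k / of_nat ?p) =
      exp (2 * of_real pi * \<i> * of_nat (k mod ?p) / of_nat ?p)" for k
  proof -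
    have k: "(of_nat k :: complex) = of_nat (k mod ?p) + of_nat ?p * of_nat (k div ?p)"
      by (simp flip: of_nat_mult of_nat_add)
    have "2 * of_real pi * \<i> * of_nat k / of_nat ?p =
        2 * of_real pi * \<i> * of_nat (k mod ?p) / of_nat ?p + 2 * of_nat (k div ?p) * of_real pi * \<i>"
      by (subst k) (use p in \<open>simp add: field_simps\<close>)
    also have "exp \<dots> = exp (2 * of_real pi * \<i> * of_nat (k mod ?p) / of_nat ?p)"
      unfolding exp_eq by (rule exI[of _ "int (k div ?p)"]) simp
    finally show ?thesis .
  qed
  moreover have "k mod ?p = l mod ?p"
    using assms by (simp add: of_nat_eq_iff_cong_CHAR cong_def)
  ultimately show ?thesis
    by metis
qed

lemma of_nat_prime_field_rep:
  assumes "\<exists>k. of_nat k = x"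
  shows "of_nat (prime_field_rep x) = x"
  using assms unfolding prime_field_rep_def by (rule LeastI_ex)

lemma of_nat_rep_trace:
  fixes x :: "'a :: {field, finite}"
  assumes "x ^ (CHAR('a) ^ e) = x"
  shows "of_nat (prime_field_rep (gf_trace CHAR('a) e x)) = gf_trace CHAR('a) e x"
  using gf_trace_fixed[of "CHAR('a)" 1 x e] assms
  by (intro of_nat_prime_field_rep fixed_by_CHAR_imp_of_nat) simp

lemma canonical_char_CHAR_power:
  fixes x :: "'a :: {field, finite}"
  shows "canonical_char (CHAR('a) ^ e) x =
    exp (2 * of_real pi * \<i> * of_nat (prime_field_rep (gf_trace CHAR('a) e x)) / of_nat CHAR('a))"
  using prime_CHAR_finite_field[where 'a = 'a]
  by (simp add: canonical_char_def prime_gt_1_nat)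

lemma canonical_char_add:
  fixes x y :: "'a :: {field, finite}"
  assumes s: "s = CHAR('a) ^ e" and x: "x ^ s = x" and y: "y ^ s = y"
  shows "canonical_char s (x + y) = canonical_char s x * canonical_char s y"
proof -
  let ?p = "CHAR('a)" and ?r = "\<lambda>x :: 'a. prime_field_rep (gf_trace CHAR('a) e x)"
  have "(x + y) ^ s = x + y"
    using freshmans_dream'[OF prime_CHAR_finite_field s, of x y] x y by simp
  then have "of_nat (?r (x + y)) = gf_trace ?p e (x + y)"
    unfolding s by (rule of_nat_rep_trace)
  also have "\<dots> = of_nat (?r x + ?r y)"
    using x y unfolding s by (simp add: of_nat_rep_trace gf_trace_add[where e = 1])
  finally have "of_nat (?r (x + y)) = (of_nat (?r x + ?r y) :: 'a)" .
  from exp_cong_CHAR[OF this] show ?thesis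
    unfolding s canonical_char_CHAR_power
    by (simp add: distrib_left add_divide_distrib exp_add)
qed

lemma canonical_char_0 [simp]: "canonical_char s (0 :: 'a :: {field, finite}) = 1"
proof -
  have "gf_trace CHAR('a) n (0 :: 'a) = 0" for n
    by (simp add: gf_trace_def power_0_left)
  moreover have "prime_field_rep (0 :: 'a) = 0"
    unfolding prime_field_rep_def by (rule Least_eq_0) simp
  ultimately show ?thesis
    by (simp add: canonical_char_def)
qed

lemma norm_canonical_char [simp]: "norm (canonical_char s x) = 1"
  by (simp add: canonical_char_def)

lemma canonical_char_minus:
  fixes x :: "'a :: {field, finite}"
  assumes s: "s = CHAR('a) ^ e" and x: "x ^ s = x"
  shows "canonical_char s (- x) = cnj (canonical_char s x)"
proof -
  have "(- x) ^ s = - x"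
    using freshmans_dream'[OF prime_CHAR_finite_field s, of x "- x"] x
    by (simp add: s power_0_left eq_neg_iff_add_eq_0 add.commute)
  then have "canonical_char s x * canonical_char s (- x) = 1"
    using canonical_char_add[OF s x, of "- x"] by simp
  moreover have "canonical_char s x * cnj (canonical_char s x) = 1"
    by (simp flip: complex_norm_square)
  ultimately show ?thesis
    by (metis mult_cancel_left mult_eq_0_iff zero_neq_one)
qed

text \<open>Both characters apply the same exponential to an absolute trace, so this is the
  transitivity of the trace.\<close>

lemma canonical_char_trace:
  fixes x :: "'a :: {field, finite}"
  assumes q: "q = CHAR('a) ^ e"
  shows "canonical_char q (gf_trace q m x) = canonical_char (q ^ m) x"
proof -
  have "q ^ m = CHAR('a) ^ (e * m)"
    by (simp add: q power_mult)
  then show ?thesis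
    by (simp add: q canonical_char_CHAR_power gf_trace_tower)
qed

lemma canonical_char_nontrivial:
  fixes K :: "'a :: {field, finite} set"
  assumes K: "is_subfield K" and cardK: "card K = CHAR('a) ^ e"
  shows "\<exists>x\<in>K. canonical_char (card K) x \<noteq> 1"
proof -
  let ?p = "CHAR('a)"
  have p: "?p > 0"
    using prime_CHAR_finite_field prime_gt_0_nat by blast
  have "e > 0"
    using card_subfield_gt_1[OF K] cardK by (cases e) auto
  then obtain x where x: "x \<in> K" "gf_trace ?p e x \<noteq> 0"
    using gf_trace_nonzero_exists[OF cardK] by blast
  let ?k = "prime_field_rep (gf_trace ?p e x)"
  have "x ^ (?p ^ e) = x"
    using x subfield_eq_fixed_points[OF K] cardK by auto
  from of_nat_rep_trace[OF this] have ndvd: "\<not> ?p dvd ?k"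
    using x(2) by (metis of_nat_eq_0_iff_char_dvd)
  have "canonical_char (card K) x \<noteq> 1"
  proof
    assume "canonical_char (card K) x = 1"
    then have "exp (2 * of_real pi * \<i> * of_nat ?k / of_nat ?p) = 1"
      by (simp add: cardK canonical_char_CHAR_power)
    then obtain n :: int where "2 * pi * real ?k / real ?p = of_int (2 * n) * pi"
      by (auto simp: exp_eq_1)
    then have "of_int (int ?k) = (of_int (n * int ?p) :: real)"
      using p by (simp add: field_simps)
    then have "int ?k = n * int ?p"
      by (simp only: of_int_eq_iff)
    then have "int ?p dvd int ?k"
      by simp
    with ndvd show False
      by (simp only: int_dvd_int_iff)
  qed
  with x(1) show ?thesis
    by blast
qed

text \<open>Translating the summation variable by an element where the character is not \<open>1\<close>
  multiplies the sum by a factor different from \<open>1\<close>.\<close>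

lemma sum_canonical_char_subfield:
  fixes K :: "'a :: {field, finite} set"
  assumes K: "is_subfield K" and cardK: "card K = CHAR('a) ^ e"
  shows "(\<Sum>y\<in>K. canonical_char (card K) y) = 0"
proof -
  let ?\<chi> = "canonical_char (card K) :: 'a \<Rightarrow> complex"
  obtain a where a: "a \<in> K" "?\<chi> a \<noteq> 1"
    using canonical_char_nontrivial[OF assms] by blast
  have fixed: "x ^ card K = x" if "x \<in> K" for x
    using that subfield_eq_fixed_points[OF K] by blast
  have "(\<Sum>y\<in>K. ?\<chi> y) = (\<Sum>y\<in>K. ?\<chi> (a + y))"
    by (rule sum.reindex_bij_witness[of _ "\<lambda>y. a + y" "\<lambda>y. - a + y"])
       (use K a in \<open>auto simp: is_subfield_def simp del: uminus_add_conv_diff\<close>)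
  also have "\<dots> = ?\<chi> a * (\<Sum>y\<in>K. ?\<chi> y)"
    by (simp add: canonical_char_add[OF cardK] fixed a sum_distrib_left)
  finally show ?thesis
    using a(2) by simp
qed

lemma canonical_char_orthogonality:
  fixes K :: "'a :: {field, finite} set"
  assumes K: "is_subfield K" and cardK: "card K = CHAR('a) ^ e" and z: "z \<in> K"
  shows "(\<Sum>y\<in>K. canonical_char (card K) (y * z)) = (if z = 0 then of_nat (card K) else 0)"
proof (cases "z = 0")
  case False
  have "(\<Sum>y\<in>K. canonical_char (card K) (y * z)) = (\<Sum>y\<in>K. canonical_char (card K) y)"
    by (rule sum.reindex_bij_witness[of _ "\<lambda>y. y * inverse z" "\<lambda>y. y * z"])
       (use K z False in \<open>auto simp: is_subfield_def\<close>)
  then show ?thesis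
    using False sum_canonical_char_subfield[OF K cardK] by simp
qed simp


section \<open>Powers of a primitive element\<close>

lemma primitive_power_card_minus_1:
  fixes \<alpha> :: "'a :: {field, finite}"
  assumes "primitive_element \<alpha>"
  shows "\<alpha> ^ (CARD('a) - 1) = 1"
  using subfield_power_card_minus_1[OF is_subfield_UNIV, of \<alpha>] assms
  by (simp add: primitive_element_def)

lemma primitive_power_mod:
  fixes \<alpha> :: "'a :: {field, finite}"
  assumes "primitive_element \<alpha>"
  shows "\<alpha> ^ k = \<alpha> ^ (k mod (CARD('a) - 1))"
proof -
  let ?n = "CARD('a) - 1"
  have "\<alpha> ^ k = \<alpha> ^ (?n * (k div ?n) + k mod ?n)"
    by (simp only: mult_div_mod_eq)
  also have "\<dots> = \<alpha> ^ (k mod ?n)"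
    by (simp only: power_add power_mult primitive_power_card_minus_1[OF assms] power_one mult_1)
  finally show ?thesis .
qed

lemma bij_betw_primitive_power:
  fixes \<alpha> :: "'a :: {field, finite}"
  assumes \<alpha>: "primitive_element \<alpha>"
  shows "bij_betw (\<lambda>k. \<alpha> ^ k) {..<CARD('a) - 1} (UNIV - {0})"
proof -
  let ?n = "CARD('a) - 1"
  have n: "?n > 0"
    using card_subfield_gt_1[OF is_subfield_UNIV, where 'a = 'a] by simp
  have img: "(\<lambda>k. \<alpha> ^ k) ` {..<?n} = UNIV - {0}"
  proof (intro equalityI subsetI)
    fix x :: 'a assume "x \<in> UNIV - {0}"
    then obtain k where "x = \<alpha> ^ k"
      using \<alpha> by (auto simp: primitive_element_def)
    then have "x = \<alpha> ^ (k mod ?n)"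
      using primitive_power_mod[OF \<alpha>, of k] by (simp only:)
    then show "x \<in> (\<lambda>k. \<alpha> ^ k) ` {..<?n}"
      by (rule image_eqI[where x = "k mod ?n"]) (use n in simp)
  qed (use \<alpha> in \<open>auto simp: primitive_element_def\<close>)
  then have "inj_on (\<lambda>k. \<alpha> ^ k) {..<?n}"
    by (intro eq_card_imp_inj_on) (simp_all add: card_Diff_singleton)
  with img show ?thesis
    by (simp add: bij_betw_def)
qed

lemma primitive_power_eq_iff:
  fixes \<alpha> :: "'a :: {field, finite}"
  assumes \<alpha>: "primitive_element \<alpha>"
  shows "\<alpha> ^ a = \<alpha> ^ b \<longleftrightarrow> [a = b] (mod (CARD('a) - 1))"
proof -
  let ?n = "CARD('a) - 1"
  have n: "?n > 0"
    using card_subfield_gt_1[OF is_subfield_UNIV, where 'a = 'a] by simp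
  have "\<alpha> ^ (a mod ?n) = \<alpha> ^ (b mod ?n) \<longleftrightarrow> a mod ?n = b mod ?n"
    using n by (intro inj_on_eq_iff[OF bij_betw_imp_inj_on[OF bij_betw_primitive_power[OF \<alpha>]]]) auto
  then show ?thesis
    using primitive_power_mod[OF \<alpha>, of a] primitive_power_mod[OF \<alpha>, of b]
    by (simp add: cong_def)
qed

lemma primitive_power_is_power_iff:
  fixes \<alpha> :: "'a :: {field, finite}"
  assumes \<alpha>: "primitive_element \<alpha>" and d: "d dvd CARD('a) - 1"
  shows "(\<exists>\<gamma>. \<alpha> ^ k = \<gamma> ^ d) \<longleftrightarrow> d dvd k"
proof
  assume "\<exists>\<gamma>. \<alpha> ^ k = \<gamma> ^ d"
  then obtain \<gamma> where \<gamma>: "\<alpha> ^ k = \<gamma> ^ d" ..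
  have "d > 0"
    using d card_subfield_gt_1[OF is_subfield_UNIV, where 'a = 'a] by (intro Nat.gr0I) simp
  moreover have "\<alpha> ^ k \<noteq> 0"
    using \<alpha> by (simp add: primitive_element_def)
  ultimately have "\<gamma> \<noteq> 0"
    using \<gamma> by (auto simp: power_0_left)
  then obtain j where "\<gamma> = \<alpha> ^ j"
    using \<alpha> by (auto simp: primitive_element_def)
  then have "\<alpha> ^ k = \<alpha> ^ (j * d)"
    using \<gamma> by (simp add: power_mult)
  then have "[k = j * d] (mod (CARD('a) - 1))"
    by (simp add: primitive_power_eq_iff[OF \<alpha>])
  then have "[k = j * d] (mod d)"
    using d by (rule cong_dvd_modulus_nat)
  then show "d dvd k"
    by (simp add: cong_dvd_iff)
next
  assume "d dvd k"
  then show "\<exists>\<gamma>. \<alpha> ^ k = \<gamma> ^ d"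
    by (metis dvd_def mult.commute power_mult)
qed

text \<open>The non-zero elements of the subfield are the elements whose order divides
  \<open>card K - 1\<close>,
  hence the powers of \<open>\<alpha>\<close> whose exponent is a multiple of \<open>Q\<close>.\<close>

lemma bij_betw_primitive_power_subfield:
  fixes \<alpha> :: "'a :: {field, finite}" and K :: "'a set"
  assumes \<alpha>: "primitive_element \<alpha>" and K: "is_subfield K"
    and Q: "CARD('a) - 1 = Q * (card K - 1)"
  shows "bij_betw (\<lambda>i. \<alpha> ^ (Q * i)) {0..card K - 2} (K - {0})"
proof -
  let ?q = "card K" and ?f = "\<lambda>i. \<alpha> ^ (Q * i)"
  have q: "?q > 1"
    by (rule card_subfield_gt_1[OF K])
  have "Q > 0"
    using Q card_subfield_gt_1[OF is_subfield_UNIV, where 'a = 'a] by (cases Q) auto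
  have inj: "inj_on ?f {0..?q - 2}"
  proof (rule inj_onI)
    fix i j assume ij: "i \<in> {0..?q - 2}" "j \<in> {0..?q - 2}" and eq: "?f i = ?f j"
    have "Q * i \<in> {..<CARD('a) - 1}" "Q * j \<in> {..<CARD('a) - 1}"
      unfolding Q using ij q \<open>Q > 0\<close> by auto
    then have "Q * i = Q * j"
      using eq inj_onD[OF bij_betw_imp_inj_on[OF bij_betw_primitive_power[OF \<alpha>]]] by blast
    then show "i = j"
      using \<open>Q > 0\<close> by simp
  qed
  have "?f ` {0..?q - 2} = K - {0}"
  proof (rule card_seteq)
    show "?f ` {0..?q - 2} \<subseteq> K - {0}"
    proof
      fix x assume "x \<in> ?f ` {0..?q - 2}"
      then obtain i where x: "x = ?f i" by blast
      have "x ^ (?q - 1) = (\<alpha> ^ (CARD('a) - 1)) ^ i"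
        unfolding x Q by (simp add: ac_simps flip: power_mult)
      then have "x ^ (?q - 1) = 1"
        by (simp only: primitive_power_card_minus_1[OF \<alpha>] power_one)
      moreover have "x ^ ?q = x * x ^ (?q - 1)"
        using q by (simp flip: power_Suc)
      ultimately have "x \<in> K"
        using subfield_eq_fixed_points[OF K] by auto
      then show "x \<in> K - {0}"
        using \<alpha> by (simp add: x primitive_element_def)
    qed
    have "0 \<in> K"
      using K by (simp add: is_subfield_def)
    then show "card (K - {0}) \<le> card (?f ` {0..?q - 2})"
      using q by (simp add: card_image[OF inj])
  qed simp
  with inj show ?thesis
    by (simp add: bij_betw_def)
qed

section \<open>N-free elements\<close>

lemma N_free_primitive_power_iff:
  fixes \<alpha> :: "'a :: {field, finite}"
  assumes \<alpha>: "primitive_element \<alpha>" and N: "N dvd CARD('a) - 1"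
  shows "N_free N (\<alpha> ^ k) \<longleftrightarrow> coprime N k"
proof -
  have "(\<exists>\<gamma>. \<alpha> ^ k = \<gamma> ^ d) \<longleftrightarrow> d dvd k" if "d dvd N" for d
    using dvd_trans[OF that N] by (rule primitive_power_is_power_iff[OF \<alpha>])
  moreover have "\<alpha> ^ k \<noteq> 0"
    using \<alpha> by (simp add: primitive_element_def)
  ultimately show ?thesis
    by (auto simp: N_free_def coprime_def)
qed

text \<open>For \<open>\<xi> = \<alpha>\<^sup>k\<close> the divisors of \<open>N\<close> in the sum are those of \<open>gcd N k\<close>, and
  \<open>\<xi>\<close> is \<open>N\<close>-free exactly when this gcd is \<open>1\<close>.\<close>

lemma sum_moebius_eq_N_free:
  fixes \<alpha> \<xi> :: "'a :: {field, finite}"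
  assumes \<alpha>: "primitive_element \<alpha>" and N: "N dvd CARD('a) - 1" "N > 0" and \<xi>: "\<xi> \<noteq> 0"
  shows "(\<Sum>d | d dvd N \<and> (\<exists>\<gamma>. \<xi> = \<gamma> ^ d). moebius d) = (if N_free N \<xi> then 1 else 0)"
proof -
  obtain k where k: "\<xi> = \<alpha> ^ k"
    using \<alpha> \<xi> by (auto simp: primitive_element_def)
  have "(\<exists>\<gamma>. \<xi> = \<gamma> ^ d) \<longleftrightarrow> d dvd k" if "d dvd N" for d
    unfolding k using dvd_trans[OF that N(1)] by (rule primitive_power_is_power_iff[OF \<alpha>])
  then have "{d. d dvd N \<and> (\<exists>\<gamma>. \<xi> = \<gamma> ^ d)} = {d. d dvd gcd N k}"
    by auto
  then have "(\<Sum>d | d dvd N \<and> (\<exists>\<gamma>. \<xi> = \<gamma> ^ d). moebius d) = (if gcd N k = 1 then 1 else 0)"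
    using N by (simp only:) (rule sum_moebius_divisors, simp)
  also have "gcd N k = 1 \<longleftrightarrow> N_free N \<xi>"
    unfolding k N_free_primitive_power_iff[OF \<alpha> N(1)] by (rule coprime_iff_gcd_eq_1[symmetric])
  finally show ?thesis .
qed

lemma card_coprime_lessThan:
  fixes N :: nat
  assumes "N > 0"
  shows "card {k. k < N \<and> coprime N k} = totient N"
proof -
  \<comment> \<open>\<open>totient\<close> counts in \<open>{0<..N}\<close>; exchanging \<open>N\<close> for \<open>0\<close> matters only if \<open>N = 1\<close>.\<close>
  consider "N = 1" | "N > 1"
    using assms by linarith
  then show ?thesis
  proof cases
    case 1
    then have "{k. k < N \<and> coprime N k} = {0}"
      by auto
    with 1 show ?thesis
      by simp
  next
    case 2
    then have "{k. k < N \<and> coprime N k} = totatives N"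
      by (auto simp: totatives_def coprime_commute[of N] le_less intro!: Nat.gr0I)
    then show ?thesis
      by (simp add: totient_def)
  qed
qed

lemma card_coprime_lessThan_mult:
  fixes N :: nat
  assumes "N > 0"
  shows "card {k. k < N * t \<and> coprime N k} = t * totient N"
proof (induction t)
  case (Suc t)
  let ?A = "{k. k < N * t \<and> coprime N k}" and ?B = "(+) (N * t) ` {k. k < N \<and> coprime N k}"
  have shift: "coprime N (N * t + j) \<longleftrightarrow> coprime N j" for j
    by (metis coprime_iff_gcd_eq_1 gcd_add_mult mult.commute)
  have "{k. k < N * Suc t \<and> coprime N k} = ?A \<union> ?B"
  proof (intro equalityI subsetI)
    fix k assume k: "k \<in> {k. k < N * Suc t \<and> coprime N k}"
    show "k \<in> ?A \<union> ?B"
    proof (cases "k < N * t")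
      case False
      then obtain j where "k = N * t + j"
        by (metis le_Suc_ex not_less)
      with k show ?thesis
        by (auto simp: shift)
    qed (use k in auto)
  qed (auto simp: shift)
  moreover have "card (?A \<union> ?B) = card ?A + card ?B"
    by (rule card_Un_disjoint) auto
  moreover have "card ?B = totient N"
    by (simp add: card_image card_coprime_lessThan[OF assms])
  ultimately show ?case
    using Suc by simp
qed simp

lemma card_N_free:
  fixes \<alpha> :: "'a :: {field, finite}"
  assumes \<alpha>: "primitive_element \<alpha>" and N: "N > 0" and n: "CARD('a) - 1 = N * t"
  shows "card {\<xi> :: 'a. N_free N \<xi>} = t * totient N"
proof -
  have dvd: "N dvd CARD('a) - 1"
    unfolding n by simp
  have "{\<xi> :: 'a. N_free N \<xi>} = (\<lambda>k. \<alpha> ^ k) ` {k. k < N * t \<and> coprime N k}"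
  proof (intro equalityI subsetI)
    fix \<xi> :: 'a assume \<xi>: "\<xi> \<in> {\<xi>. N_free N \<xi>}"
    then have "\<xi> \<in> UNIV - {0}"
      by (simp add: N_free_def)
    then obtain k where "k < N * t" "\<xi> = \<alpha> ^ k"
      using bij_betw_imp_surj_on[OF bij_betw_primitive_power[OF \<alpha>]] n by (metis imageE lessThan_iff)
    with \<xi> show "\<xi> \<in> (\<lambda>k. \<alpha> ^ k) ` {k. k < N * t \<and> coprime N k}"
      by (auto simp: N_free_primitive_power_iff[OF \<alpha> dvd])
  qed (auto simp: N_free_primitive_power_iff[OF \<alpha> dvd])
  moreover have "inj_on (\<lambda>k. \<alpha> ^ k) {k. k < N * t \<and> coprime N k}"
    by (rule inj_on_subset[OF bij_betw_imp_inj_on[OF bij_betw_primitive_power[OF \<alpha>]]])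
       (unfold n, auto)
  ultimately show ?thesis
    by (simp add: card_image card_coprime_lessThan_mult[OF N])
qed

section \<open>Gaussian periods and character sums over N-free elements\<close>

text \<open>Every non-zero \<open>d\<close>-th power is an integer power of \<open>\<alpha>\<^sup>d\<close>, so the cosets in the Gaussian
  periods are translates of the set of \<open>d\<close>-th powers, which appears in the definition of
  \<open>N\<close>-free elements.\<close>

lemma power_coset_eq_image:
  fixes \<alpha> :: "'a :: {field, finite}"
  assumes \<alpha>: "primitive_element \<alpha>" and "d > 0"
  shows "power_coset \<alpha> (int j) d = (*) (\<alpha> ^ j) ` {\<xi>. \<xi> \<noteq> 0 \<and> (\<exists>\<gamma>. \<xi> = \<gamma> ^ d)}"
proof -
  have \<alpha>0: "\<alpha> \<noteq> 0"
    using \<alpha> by (simp add: primitive_element_def)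
  have "range (\<lambda>i. (\<alpha> ^ d) powi i) = {\<xi>. \<xi> \<noteq> 0 \<and> (\<exists>\<gamma>. \<xi> = \<gamma> ^ d)}"
  proof (intro equalityI subsetI)
    fix \<xi> assume "\<xi> \<in> range (\<lambda>i. (\<alpha> ^ d) powi i)"
    then obtain i where i: "\<xi> = (\<alpha> ^ d) powi i" by blast
    have "\<xi> = (\<alpha> powi i) ^ d"
      unfolding i power_int_power power_int_power' by (simp only: mult.commute)
    then show "\<xi> \<in> {\<xi>. \<xi> \<noteq> 0 \<and> (\<exists>\<gamma>. \<xi> = \<gamma> ^ d)}"
      using \<alpha>0 by auto
  next
    fix \<xi> :: 'a assume "\<xi> \<in> {\<xi>. \<xi> \<noteq> 0 \<and> (\<exists>\<gamma>. \<xi> = \<gamma> ^ d)}"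
    then obtain \<gamma> where \<gamma>: "\<xi> = \<gamma> ^ d" and "\<xi> \<noteq> 0"
      by blast
    then have "\<gamma> \<noteq> 0"
      using \<open>d > 0\<close> by (auto simp: power_0_left)
    then obtain l where "\<gamma> = \<alpha> ^ l"
      using \<alpha> by (auto simp: primitive_element_def)
    then have "\<xi> = (\<alpha> ^ d) powi int l"
      using \<gamma> by (simp add: mult.commute flip: power_mult)
    then show "\<xi> \<in> range (\<lambda>i. (\<alpha> ^ d) powi i)"
      by blast
  qed
  then show ?thesis
    by (simp add: power_coset_def image_image full_SetCompr_eq flip: image_image)
qed

text \<open>Expanding the Gaussian periods and exchanging the sums attaches to each \<open>\<xi>\<close> the
  Moebius sum over the divisors \<open>d\<close> of \<open>N\<close> for which \<open>\<xi>\<close> is a \<open>d\<close>-th power.\<close>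

lemma Delta_eq_sum_N_free:
  fixes \<alpha> :: "'a :: {field, finite}"
  assumes \<alpha>: "primitive_element \<alpha>" and N: "N dvd CARD('a) - 1" "N > 0"
  shows "Delta \<alpha> (int j) N = (\<Sum>\<xi> | N_free N \<xi>. canonical_char CARD('a) (\<alpha> ^ j * \<xi>))"
proof -
  let ?\<chi> = "\<lambda>\<xi>. canonical_char CARD('a) (\<alpha> ^ j * \<xi>)"
  let ?pow = "\<lambda>d (\<xi> :: 'a). \<exists>\<gamma>. \<xi> = \<gamma> ^ d"
  have \<alpha>0: "\<alpha> \<noteq> 0"
    using \<alpha> by (simp add: primitive_element_def)
  have fin: "finite {d. d dvd N}"
    using N by simp
  have period: "gaussian_period \<alpha> d (int j) = (\<Sum>\<xi> | \<xi> \<noteq> 0 \<and> ?pow d \<xi>. ?\<chi> \<xi>)" if "d dvd N" for d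
  proof -
    have "d > 0"
      using that N by (intro Nat.gr0I) auto
    then show ?thesis
      unfolding gaussian_period_def power_coset_eq_image[OF \<alpha> \<open>d > 0\<close>]
      using \<alpha>0 by (subst sum.reindex) (auto intro!: inj_onI)
  qed
  have "Delta \<alpha> (int j) N =
      (\<Sum>d | d dvd N. \<Sum>\<xi> | \<xi> \<noteq> 0 \<and> ?pow d \<xi>. of_int (moebius d) * ?\<chi> \<xi>)"
    by (simp add: Delta_def period sum_distrib_left)
  also have "\<dots> = (\<Sum>\<xi>\<in>UNIV - {0}. \<Sum>d | d dvd N \<and> ?pow d \<xi>. of_int (moebius d) * ?\<chi> \<xi>)"
    using sum.swap_restrict[OF fin, of "UNIV - {0}"
        "\<lambda>d \<xi>. of_int (moebius d) * ?\<chi> \<xi>" ?pow] by simp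
  also have "\<dots> = (\<Sum>\<xi>\<in>UNIV - {0}. of_int (\<Sum>d | d dvd N \<and> ?pow d \<xi>. moebius d) * ?\<chi> \<xi>)"
    by (simp add: sum_distrib_right)
  also have "\<dots> = (\<Sum>\<xi>\<in>UNIV - {0}. if N_free N \<xi> then ?\<chi> \<xi> else 0)"
    by (intro sum.cong) (simp_all add: sum_moebius_eq_N_free[OF \<alpha> N] del: of_int_sum)
  also have "\<dots> = (\<Sum>\<xi> | N_free N \<xi>. ?\<chi> \<xi>)"
    by (rule sum.mono_neutral_cong_right) (auto simp: N_free_def)
  finally show ?thesis .
qed

section \<open>Counting N-free elements of prescribed trace\<close>

lemma CARD_prime_power_imp_CHAR:
  assumes "prime r" and "CARD('a :: {field, finite}) = r ^ k"
  shows "CHAR('a) = r"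
proof -
  have "CHAR('a) dvd r ^ k"
    using CHAR_dvd_CARD[where 'a = 'a] assms(2) by simp
  then have "CHAR('a) dvd r"
    using prime_CHAR_finite_field prime_dvd_power by blast
  then show ?thesis
    using assms(1) prime_CHAR_finite_field primes_dvd_imp_eq by blast
qed

theorem lemma3p4:
  fixes q m Q N :: nat
    and K :: "'a :: {field, finite} set"
    and \<alpha> c :: 'a
  assumes "primepow q"
    and "m > 0"
    and "CARD('a) = q ^ m"
    and "is_subfield K"
    and "card K = q"
    and "Q = (q ^ m - 1) div (q - 1)"
    and "primitive_element \<alpha>"
    and "N > 0"
    and "N dvd q ^ m - 1"
    and "c \<in> K"
  shows "of_nat (Z_count q m N c) =
    1 / of_nat q *
      (of_nat (q ^ m - 1) / of_nat N * of_nat (totient N) + f_sum q Q \<alpha> 0 N c (Delta \<alpha>))"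
proof -
  note CARD = \<open>CARD('a) = q ^ m\<close> and K = \<open>is_subfield K\<close> and cardK = \<open>card K = q\<close>
    and \<alpha> = \<open>primitive_element \<alpha>\<close>
  obtain r e where "prime r" "q = r ^ e"
    using \<open>primepow q\<close> by (auto simp: primepow_def)
  then have q: "q = CHAR('a) ^ e"
    using CARD_prime_power_imp_CHAR[of r "e * m", where 'a = 'a] CARD by (simp add: power_mult)
  have q1: "q > 1"
    using card_subfield_gt_1[OF K] cardK by simp
  have cardK': "card K = CHAR('a) ^ e"
    using cardK q by simp
  have in_K_iff: "x \<in> K \<longleftrightarrow> x ^ q = x" for x
    using subfield_eq_fixed_points[OF K] cardK by auto
  let ?F = "{\<xi> :: 'a. N_free N \<xi>}" and ?\<chi> = "canonical_char q :: 'a \<Rightarrow> complex"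
    and ?Tr = "gf_trace q m :: 'a \<Rightarrow> 'a"
  have "\<xi> ^ (q ^ m) = \<xi>" for \<xi> :: 'a
    using subfield_eq_fixed_points[OF is_subfield_UNIV[where 'a = 'a]] CARD by auto
  then have Tr_K: "?Tr \<xi> \<in> K" for \<xi>
    unfolding in_K_iff by (rule gf_trace_fixed[OF q])
  have minus_K: "?Tr \<xi> - c \<in> K" for \<xi>
    using Tr_K[of \<xi>] \<open>c \<in> K\<close> K unfolding is_subfield_def by (metis diff_conv_add_uminus)
  \<comment> \<open>This separates the dependence on \<open>c\<close> from that on \<open>\<xi>\<close>; the factors are those of
    \<open>f_sum\<close> and of \<open>Delta\<close>.\<close>
  have split: "?\<chi> (y * (?Tr \<xi> - c)) = cnj (?\<chi> (y * c)) * canonical_char CARD('a) (y * \<xi>)"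
    if y: "y \<in> K" for y \<xi>
  proof -
    have "y * ?Tr \<xi> \<in> K" "y * c \<in> K" "- (y * c) \<in> K"
      using y Tr_K[of \<xi>] \<open>c \<in> K\<close> K by (auto simp: is_subfield_def)
    then have fixed: "(y * ?Tr \<xi>) ^ q = y * ?Tr \<xi>" "(y * c) ^ q = y * c" "(- (y * c)) ^ q = - (y * c)"
      unfolding in_K_iff by blast+
    have "?\<chi> (y * (?Tr \<xi> - c)) = ?\<chi> (y * ?Tr \<xi> + - (y * c))"
      by (simp add: algebra_simps)
    also have "\<dots> = ?\<chi> (y * ?Tr \<xi>) * cnj (?\<chi> (y * c))"
      by (simp only: canonical_char_add[OF q fixed(1,3)] canonical_char_minus[OF q fixed(2)])
    also have "?\<chi> (y * ?Tr \<xi>) = canonical_char CARD('a) (y * \<xi>)"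
      using y canonical_char_trace[OF q, of m "y * \<xi>"]
      by (simp add: gf_trace_scale in_K_iff CARD)
    finally show ?thesis
      by (simp add: mult.commute)
  qed
  obtain t where t: "q ^ m - 1 = N * t"
    using \<open>N dvd q ^ m - 1\<close> ..
  have card_F: "card ?F = t * totient N"
    by (rule card_N_free[OF \<alpha> \<open>N > 0\<close>]) (simp only: CARD t)
  have "q - 1 dvd q ^ m - 1"
  proof -
    have "[q ^ m = 1 ^ m] (mod (q - 1))"
      using q1 by (intro cong_pow) (simp add: cong_altdef_nat)
    then show ?thesis
      using q1 by (simp add: cong_altdef_nat)
  qed
  then have Q: "CARD('a) - 1 = Q * (card K - 1)"
    by (simp add: CARD cardK \<open>Q = (q ^ m - 1) div (q - 1)\<close>)
  have N_dvd: "N dvd CARD('a) - 1"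
    unfolding CARD t by simp

  have "of_nat q * of_nat (Z_count q m N c) = (\<Sum>\<xi>\<in>?F. if ?Tr \<xi> = c then of_nat q else (0 :: complex))"
    by (simp add: Z_count_def sum.If_cases Int_def mult.commute)
  also have "\<dots> = (\<Sum>\<xi>\<in>?F. \<Sum>y\<in>K. ?\<chi> (y * (?Tr \<xi> - c)))"
    using canonical_char_orthogonality[OF K cardK' minus_K, unfolded cardK] by simp
  also have "\<dots> = (\<Sum>y\<in>K. cnj (?\<chi> (y * c)) * (\<Sum>\<xi>\<in>?F. canonical_char CARD('a) (y * \<xi>)))"
    by (subst sum.swap) (simp add: split sum_distrib_left)
  also have "\<dots> = of_nat (card ?F) +
      (\<Sum>y\<in>K - {0}. cnj (?\<chi> (y * c)) * (\<Sum>\<xi>\<in>?F. canonical_char CARD('a) (y * \<xi>)))"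
    using K by (subst sum.remove[of K 0]) (auto simp: is_subfield_def)
  also have "(\<Sum>y\<in>K - {0}. cnj (?\<chi> (y * c)) * (\<Sum>\<xi>\<in>?F. canonical_char CARD('a) (y * \<xi>))) =
      (\<Sum>i = 0..q - 2. cnj (?\<chi> (\<alpha> ^ (Q * i) * c)) *
        (\<Sum>\<xi>\<in>?F. canonical_char CARD('a) (\<alpha> ^ (Q * i) * \<xi>)))"
    using sum.reindex_bij_betw[OF bij_betw_primitive_power_subfield[OF \<alpha> K Q], symmetric]
    by (simp add: cardK)
  also have "\<dots> = f_sum q Q \<alpha> 0 N c (Delta \<alpha>)"
    unfolding f_sum_def add_0_right
    by (simp only: Delta_eq_sum_N_free[OF \<alpha> N_dvd \<open>N > 0\<close>])
  finally have "of_nat q * of_nat (Z_count q m N c) =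
      of_nat (t * totient N) + f_sum q Q \<alpha> 0 N c (Delta \<alpha>)"
    by (simp only: card_F)
  moreover have "of_nat (q ^ m - 1) / of_nat N * of_nat (totient N) = (of_nat (t * totient N) :: complex)"
    unfolding t using \<open>N > 0\<close> by simp
  ultimately show ?thesis
    using q1 by (simp add: field_simps)
qed

end
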